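(* Let $b>0$ be a real number and let $N_{\rm r}$ be a positive integer with $\sqrt{N_{\rm r}}\in\mathbb{Z}_+$. Consider uniform planar arrays with $N_{\rm r}$ antennas in total and half-wavelength antenna spacing, i.e. $\Delta_{\rm r,h}=\Delta_{\rm r,v}=\frac12$. Then, among all pairs of positive integers $(N_{\rm r,h},N_{\rm r,v})$ with $N_{\rm r,h}N_{\rm r,v}=N_{\rm r}$, the optimal configuration, i.e. the unique minimizer of the beam squint ratio $$\mathrm{BSR}(N_{\rm r,h},N_{\rm r,v})=\frac{b}{8}\max\left(N_{\rm r,h}\Delta_{\rm r,h},\,N_{\rm r,v}\Delta_{\rm r,v}\right),$$ is $N_{\rm r,h}=N_{\rm r,v}=\sqrt{N_{\rm r}}$.
   Context: A uniform planar array (UPA) of size $N_{\rm r,h}\times N_{\rm r,v}$ has $N_{\rm r,h}$ antennas in the horizontal dimension and $N_{\rm r,v}$ antennas in the vertical dimension, with total number of antennas $N_{\rm r}=N_{\rm r,h}N_{\rm r,v}$. The numbers $\Delta_{\rm r,h},\Delta_{\rm r,v}$ are the antenna spacings in the horizontal and vertical dimensions, normalized by the wavelength of the central frequency $f_{\rm c}$. The fractional bandwidth is $b=B/f_{\rm c}$, where $B>0$ is the bandwidth and $f_{\rm c}>0$ the central frequency. The beam squint ratio (BSR), which quantifies the severity of the beam squint effect, is here given by the closed-form expression $\frac{b}{8}\max(N_{\rm r,h}\Delta_{\rm r,h},N_{\rm r,v}\Delta_{\rm r,v})$. $\mathbb{Z}_+$ denotes the positive integers. *)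

theory Defs
  imports Complex_Main
begin

text \<open>A uniform planar array is given by its numbers of antennas \<open>(N_h, N_v)\<close> in the horizontal
  and vertical dimension; the spacings \<open>d_h\<close>, \<open>d_v\<close> are normalized by the wavelength of the
  central frequency, and \<open>b\<close> is the fractional bandwidth.\<close>

definition upa_sizes :: "nat \<Rightarrow> (nat \<times> nat) set" where
  "upa_sizes N = {(N_h, N_v). 0 < N_h \<and> 0 < N_v \<and> N_h * N_v = N}"

definition BSR :: "real \<Rightarrow> real \<Rightarrow> real \<Rightarrow> nat \<times> nat \<Rightarrow> real" where
  "BSR b d_h d_v = (\<lambda>(N_h, N_v). b / 8 * max (real N_h * d_h) (real N_v * d_v))"

end

theory Submission
  imports Defs
begin

text \<open>At half-wavelength spacing the ratio is a positive multiple of the longer side of the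
  array (\<open>BSR_half\<close>), so only \<open>max h v\<close> matters. Among factorizations of a
  perfect square \<open>n * n\<close>, every non-square one has a side exceeding \<open>n\<close>
  (\<open>max_gt_sqrt\<close>). The square array thus beats each competitor strictly, which yields
  optimality and uniqueness at once.\<close>

lemma BSR_half: "BSR b (1 / 2) (1 / 2) (h, v) = b / 16 * real (max h v)"
  by (auto simp: BSR_def max_def)

text \<open>If both factors were at most \<open>n\<close>, one of them would be strictly smaller,
  and the product would fall short of \<open>n * n\<close>.\<close>

lemma max_gt_sqrt:
  fixes h v n :: nat
  assumes "h * v = n * n" and "(h, v) \<noteq> (n, n)"
  shows "n < max h v"
proof (rule ccontr)
  assume "\<not> n < max h v"
  then have le: "h \<le> n" "v \<le> n" by auto
  with assms(2) have "h < n \<or> v < n" by auto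
  then have "h * v < n * n"
  proof
    assume "h < n"
    \<comment> \<open>Strictness of the second inequality needs \<open>n > 0\<close>, which
      \<open>h < n\<close> supplies.\<close>
    then have "h * v \<le> h * n" and "h * n < n * n" using le by simp_all
    then show ?thesis by linarith
  next
    assume "v < n"
    then have "h * v \<le> n * v" and "n * v < n * n" using le by simp_all
    then show ?thesis by linarith
  qed
  with assms(1) show False by simp
qed

theorem corollary1:
  fixes b d_h d_v :: real and N :: nat
  assumes "b > 0"
    and "N > 0"
    and "sqrt (real N) \<in> real ` {n. 0 < n}"
    and "d_h = 1 / 2"
    and "d_v = 1 / 2"
  shows "\<exists>n. real n = sqrt (real N) \<and>
    {p. is_arg_min (BSR b d_h d_v) (\<lambda>p. p \<in> upa_sizes N) p} = {(n, n)}"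
proof -
  obtain n where n: "0 < n" "sqrt (real N) = real n"
    using assms(3) by auto
  then have "real N = real (n * n)"
    by (metis of_nat_0_le_iff of_nat_mult real_sqrt_mult_self abs_of_nonneg)
  then have N: "N = n * n"
    using of_nat_eq_iff by blast
  let ?f = "BSR b d_h d_v"
  have square: "(n, n) \<in> upa_sizes N"
    using n(1) N by (simp add: upa_sizes_def)
  have less: "?f (n, n) < ?f p" if "p \<in> upa_sizes N" and "p \<noteq> (n, n)" for p
  proof -
    obtain h v where p: "p = (h, v)" by fastforce
    with that N have "n < max h v"
      by (intro max_gt_sqrt) (auto simp: upa_sizes_def)
    then have "b / 16 * real n < b / 16 * real (max h v)"
      using assms(1) by (intro mult_strict_left_mono) (simp_all del: of_nat_max)
    then show ?thesis
      by (simp only: p assms(4,5) BSR_half max.idem)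
  qed
  \<comment> \<open>\<open>is_arg_min\<close> only says that no feasible point is strictly better:
    \<open>less\<close> rules out every other \<open>p\<close>, and by asymmetry of the order
    nothing beats the square.\<close>
  have "is_arg_min ?f (\<lambda>p. p \<in> upa_sizes N) p \<longleftrightarrow> p = (n, n)" for p
    unfolding is_arg_min_def using square less by (metis less_asym less_irrefl)
  then have "{p. is_arg_min ?f (\<lambda>p. p \<in> upa_sizes N) p} = {(n, n)}"
    by auto
  with n(2) show ?thesis by auto
qed

end
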